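(* Let $(\mathrm{A},.)$ be a finite dimensional associative algebra over a field of characteristic $0$, and let $[u,v]=u.v-v.u$. Then $(\mathrm{A},.)$ is Poisson admissible if and only if $(\mathrm{A},[\,,\,])$ is a 2-nilpotent Lie algebra.
   Context: A Lie algebra is called 2-nilpotent if $[[u,v],w]=0$ for all $u,v,w$. Associative algebras are not assumed unital. A Poisson algebra is a finite dimensional Lie algebra $(\mathfrak{g},[\,,\,])$ endowed with a commutative and associative product $\circ$ such that $[u,v\circ w]=[u,v]\circ w+v\circ[u,w]$ for all $u,v,w$. An algebra $(\mathrm{A},.)$ is called Poisson admissible if $(\mathrm{A},[\,,\,],\circ)$ is a Poisson algebra, where $[u,v]=u.v-v.u$ and $u\circ v=\frac12(u.v+v.u)$. *)

theory Defs imports Complex_Main begin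

text \<open>Nonassociative algebras: a bilinear product on the vector space formed by the whole type \<open>'a\<close>.\<close>

locale algebra_over = vector_space scale
  for scale :: "'k::field \<Rightarrow> 'a::ab_group_add \<Rightarrow> 'a" +
  fixes mult :: "'a \<Rightarrow> 'a \<Rightarrow> 'a"
  assumes linear_left: "Vector_Spaces.linear scale scale (\<lambda>u. mult u v)"
    and linear_right: "Vector_Spaces.linear scale scale (\<lambda>v. mult u v)"

text \<open>The library locale fixes a finite basis; here only its existence is required.\<close>

definition finite_dimensional :: "('k::field \<Rightarrow> 'a::ab_group_add \<Rightarrow> 'a) \<Rightarrow> bool" where
  "finite_dimensional scale \<longleftrightarrow> (\<exists>Basis. finite_dimensional_vector_space scale Basis)"

locale associative_algebra = algebra_over +
  assumes assoc: "mult (mult u v) w = mult u (mult v w)"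

locale commutative_associative_algebra = associative_algebra +
  assumes commute: "mult u v = mult v u"

locale lie_algebra = algebra_over +
  assumes alternating: "mult u u = 0"
    and jacobi: "mult u (mult v w) + mult v (mult w u) + mult w (mult u v) = 0"

locale two_nilpotent_lie_algebra = lie_algebra +
  assumes two_nilpotent: "mult (mult u v) w = 0"

locale poisson_algebra =
  lie: lie_algebra scale bracket + comm: commutative_associative_algebra scale circ
  for scale :: "'k::field \<Rightarrow> 'a::ab_group_add \<Rightarrow> 'a"
    and bracket circ :: "'a \<Rightarrow> 'a \<Rightarrow> 'a" +
  assumes finite_dim: "finite_dimensional scale"
    and leibniz: "bracket u (circ v w) = circ (bracket u v) w + circ v (bracket u w)"

definition commutator :: "('a \<Rightarrow> 'a \<Rightarrow> 'a) \<Rightarrow> 'a \<Rightarrow> 'a \<Rightarrow> 'a::ab_group_add" where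
  "commutator mult u v = mult u v - mult v u"

definition symmetrized ::
  "('k::field_char_0 \<Rightarrow> 'a::ab_group_add \<Rightarrow> 'a) \<Rightarrow> ('a \<Rightarrow> 'a \<Rightarrow> 'a) \<Rightarrow> 'a \<Rightarrow> 'a \<Rightarrow> 'a" where
  "symmetrized scale mult u v = scale (1 / 2) (mult u v + mult v u)"

definition poisson_admissible ::
  "('k::field_char_0 \<Rightarrow> 'a::ab_group_add \<Rightarrow> 'a) \<Rightarrow> ('a \<Rightarrow> 'a \<Rightarrow> 'a) \<Rightarrow> bool" where
  "poisson_admissible scale mult \<longleftrightarrow>
     algebra_over scale mult \<and>
     poisson_algebra scale (commutator mult) (symmetrized scale mult)"

end

theory Submission imports Defs begin

text \<open>For an associative product, the associator of the symmetrized product is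
  \<open>(u \<circ> v) \<circ> w - u \<circ> (v \<circ> w) = [v, [u, w]] / 4\<close>, so \<open>\<circ>\<close> is associative exactly when the
  commutator bracket is 2-nilpotent. All the other Poisson axioms hold automatically: the
  commutator is a Lie bracket, and it acts by derivations of the product, hence of \<open>\<circ>\<close>.\<close>

lemma (in vector_space) algebra_overI:
  assumes "\<And>u v w. m (u + v) w = m u w + m v w"
    and "\<And>c u v. m (scale c u) v = scale c (m u v)"
    and "\<And>u v w. m u (v + w) = m u v + m u w"
    and "\<And>c u v. m u (scale c v) = scale c (m u v)"
  shows "algebra_over scale m"
proof -
  have "Vector_Spaces.linear scale scale f"
    if "\<And>u v. f (u + v) = f u + f v" "\<And>c u. f (scale c u) = scale c (f u)" for f
    by unfold_locales (simp_all add: that)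
  then show ?thesis
    using assms by unfold_locales auto
qed

context algebra_over
begin

lemma mult_add_left: "mult (u + v) w = mult u w + mult v w"
  and mult_diff_left: "mult (u - v) w = mult u w - mult v w"
  and mult_scale_left: "mult (scale c u) w = scale c (mult u w)"
proof -
  interpret L: Vector_Spaces.linear scale scale "\<lambda>u. mult u w"
    by (rule linear_left)
  show "mult (u + v) w = mult u w + mult v w"
    by (rule L.add)
  show "mult (u - v) w = mult u w - mult v w"
    by (rule L.diff)
  show "mult (scale c u) w = scale c (mult u w)"
    by (rule L.scale)
qed

lemma mult_add_right: "mult u (v + w) = mult u v + mult u w"
  and mult_diff_right: "mult u (v - w) = mult u v - mult u w"
  and mult_scale_right: "mult u (scale c v) = scale c (mult u v)"
proof -
  interpret R: Vector_Spaces.linear scale scale "\<lambda>v. mult u v"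
    by (rule linear_right)
  show "mult u (v + w) = mult u v + mult u w"
    by (rule R.add)
  show "mult u (v - w) = mult u v - mult u w"
    by (rule R.diff)
  show "mult u (scale c v) = scale c (mult u v)"
    by (rule R.scale)
qed

lemmas mult_simps = mult_add_left mult_diff_left mult_scale_left
  mult_add_right mult_diff_right mult_scale_right

lemma algebra_over_commutator: "algebra_over scale (commutator mult)"
  by (rule algebra_overI)
    (simp_all add: commutator_def mult_simps scale_right_diff_distrib)

end

text \<open>Placed outside \<open>algebra_over\<close>, whose scalars form an arbitrary field, since
  \<open>symmetrized\<close> is typed over characteristic 0.\<close>

lemma algebra_over_symmetrized:
  assumes "algebra_over scale mult"
  shows "algebra_over scale (symmetrized scale mult)"
proof -
  interpret algebra_over scale mult by (rule assms)
  show ?thesis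
    by (rule algebra_overI)
      (simp_all add: symmetrized_def mult_simps scale_right_distrib mult.commute add_ac)
qed

text \<open>The Jacobi sum expands into twelve words in u, v, w, which cancel in pairs once
  \<open>assoc\<close> rebrackets them.\<close>

lemma (in associative_algebra) lie_algebra_commutator: "lie_algebra scale (commutator mult)"
proof -
  interpret C: algebra_over scale "commutator mult"
    by (rule algebra_over_commutator)
  show ?thesis
    by unfold_locales (simp_all add: commutator_def mult_simps assoc)
qed

lemma symmetrized_commute: "symmetrized scale mult u v = symmetrized scale mult v u"
  by (simp add: symmetrized_def add.commute)

text \<open>By associativity, bracketing with u is a derivation of \<open>mult\<close>, hence also
  of the opposite product and of half the sum of the two.\<close>

lemma commutator_symmetrized:
  assumes "associative_algebra scale mult"
  shows "commutator mult u (symmetrized scale mult v w) =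
    symmetrized scale mult (commutator mult u v) w +
    symmetrized scale mult v (commutator mult u w)"
proof -
  interpret associative_algebra scale mult by (rule assms)
  show ?thesis
    \<comment> \<open>Collecting the factor 1/2 in front on each side leaves an identity between
      sums of words.\<close>
    unfolding commutator_def symmetrized_def mult_scale_left mult_scale_right
      scale_right_diff_distrib[symmetric] scale_right_distrib[symmetric]
    by (simp add: mult_simps assoc)
qed

text \<open>In four times the left side the words uvw and wvu cancel; what remains is vuw - vwu -
  uwv + wuv, the expansion of [v, [u, w]].\<close>

lemma symmetrized_associator:
  assumes "associative_algebra scale mult"
  shows "symmetrized scale mult (symmetrized scale mult u v) w -
      symmetrized scale mult u (symmetrized scale mult v w) =
    scale (1 / 4) (commutator mult v (commutator mult u w))"
proof -
  interpret associative_algebra scale mult by (rule assms)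
  show ?thesis
    unfolding commutator_def symmetrized_def mult_scale_left mult_scale_right
      scale_right_diff_distrib[symmetric] scale_right_distrib[symmetric] scale_scale
    by (simp add: mult_simps assoc algebra_simps)
qed

theorem corollary3p1:
  fixes scale :: "'k::field_char_0 \<Rightarrow> 'a::ab_group_add \<Rightarrow> 'a"
    and mult :: "'a \<Rightarrow> 'a \<Rightarrow> 'a"
  assumes "associative_algebra scale mult"
    and "finite_dimensional scale"
  shows "poisson_admissible scale mult \<longleftrightarrow> two_nilpotent_lie_algebra scale (commutator mult)"
proof -
  interpret associative_algebra scale mult by (rule assms)
  interpret L: lie_algebra scale "commutator mult" by (rule lie_algebra_commutator)
  interpret S: algebra_over scale "symmetrized scale mult"
    by (rule algebra_over_symmetrized) (rule algebra_over_axioms)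
  \<comment> \<open>Turns the [v, [u, w]] of the associator into the left-nested form used by
    \<open>two_nilpotent\<close>.\<close>
  have skew: "commutator mult u v = - commutator mult v u" for u v
    by (simp add: commutator_def)
  \<comment> \<open>The factor 1/4 is nonzero, so the associator vanishes exactly when the double
    bracket does.\<close>
  have assoc_iff: "symmetrized scale mult (symmetrized scale mult u v) w =
      symmetrized scale mult u (symmetrized scale mult v w) \<longleftrightarrow>
      commutator mult (commutator mult u w) v = 0" for u v w
    using symmetrized_associator[OF assms(1), of u v w] skew[of v "commutator mult u w"]
    by (metis eq_iff_diff_eq_0 neg_equal_0_iff_equal scale_eq_0_iff zero_neq_numeral
        divide_eq_0_iff zero_neq_one)
  show ?thesis
  proof
    assume "poisson_admissible scale mult"
    then interpret P: poisson_algebra scale "commutator mult" "symmetrized scale mult"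
      by (simp add: poisson_admissible_def)
    show "two_nilpotent_lie_algebra scale (commutator mult)"
      \<comment> \<open>[[u, v], w] = 0 comes from associativity at the triple u, w, v: the middle
        factor becomes the outer argument.\<close>
      by unfold_locales (use assoc_iff P.comm.assoc in blast)
  next
    assume "two_nilpotent_lie_algebra scale (commutator mult)"
    then interpret N: two_nilpotent_lie_algebra scale "commutator mult" .
    have "poisson_algebra scale (commutator mult) (symmetrized scale mult)"
      \<comment> \<open>The interpretations \<open>L\<close> and \<open>S\<close> supply the Lie
        axioms and bilinearity; associativity, commutativity, finite dimension and Leibniz
        remain.\<close>
      by unfold_locales
        (use assoc_iff N.two_nilpotent assms(2) commutator_symmetrized[OF assms(1)]
          symmetrized_commute[of scale mult] in blast)+
    then show "poisson_admissible scale mult"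
      by (simp add: poisson_admissible_def algebra_over_axioms)
  qed
qed

end
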